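(* The weight basis $\{v_{T',T}\}$ of $\mathbb{C}[S_n]$ (indexed by pairs $T,T'$ of standard tableaux with $n$ boxes of the same shape) is orthogonal under the standard $S_n$-invariant inner product on $\mathbb{C}[S_n]$, i.e. the one for which the group elements form an orthonormal basis: $\langle g,g'\rangle=\delta_{g,g'}$ for $g,g'\in S_n$.
   Context: $S_k\subseteq S_n$ is the subgroup fixing $k+1,\ldots,n$. $X_k=(1\ k)+\cdots+(k-1\ k)\in\mathbb{C}[S_n]$, $X_1=0$. The content of a box of a Young diagram is (column index) $-$ (row index). A standard tableau of shape $\lambda\vdash n$ is a filling of the boxes of $\lambda$ by $1,\ldots,n$, each used once, increasing along rows and down columns. $b(T,i)$ is the box of $T$ containing $i$, $T^{(i)}$ the subtableau formed by $1,\ldots,i$. For a partition $\lambda$ of $k$, $V_\lambda$ denotes the irreducible complex $S_k$-module (Young's seminormal form) having a basis $\{v_T\}$ indexed by standard tableaux $T$ of shape $\lambda$ with $X_i\cdot v_T=\mathrm{cont}(b(T,i))\,v_T$ for all $i$. Given a standard tableau $T$ with $n$ boxes, let $V_{T^{(1)}}=\mathbb{C}[S_1]$ and for $2\le k\le n$ let $V_{T^{(k)}}\subseteq\mathbb{C}[S_k]$ be the unique irreducible left $S_k$-submodule of $\mathrm{Ind}_{S_{k-1}}^{S_k}V_{T^{(k-1)}}=\mathbb{C}[S_k]\cdot V_{T^{(k-1)}}$ isomorphic to $V_{\mathrm{shape}(T^{(k)})}$ (the induced module is multiplicity-free). Put $V_T:=V_{T^{(n)}}\subseteq\mathbb{C}[S_n]$.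 For $T'$ standard of the same shape as $T$, $v_{T',T}$ is the vector (unique up to nonzero scalar) in $V_T$ with $X_i\cdot v_{T',T}=\mathrm{cont}(b(T',i))\,v_{T',T}$ for all $i$. The vectors $v_{T',T}$ form a basis of $\mathbb{C}[S_n]$, called the weight basis. *)

theory Defs
  imports Complex_Main "HOL-Combinatorics.Permutations" "HOL-Library.Function_Algebras"
begin

definition cscale :: "complex \<Rightarrow> ('b \<Rightarrow> complex) \<Rightarrow> 'b \<Rightarrow> complex" where
  "cscale c f = (\<lambda>x. c * f x)"

global_interpretation cfun: vector_space "cscale :: complex \<Rightarrow> ('b \<Rightarrow> complex) \<Rightarrow> 'b \<Rightarrow> complex"
  by unfold_locales (auto simp: cscale_def fun_eq_iff algebra_simps)

text \<open>The group \<open>S\<^sub>k\<close> is the set of \<open>p\<close> with \<open>p permutes {1..k}\<close>, composed as functions, so that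
  \<open>S\<^sub>k \<subseteq> S\<^sub>n\<close> for \<open>k \<le> n\<close>. Modules live on subspaces of function spaces \<open>'b \<Rightarrow> complex\<close>; up to
  isomorphism every complex vector space is of this form.\<close>

locale sym_module =
  fixes k :: nat
    and W :: "('b \<Rightarrow> complex) set"
    and act :: "(nat \<Rightarrow> nat) \<Rightarrow> ('b \<Rightarrow> complex) \<Rightarrow> 'b \<Rightarrow> complex"
  assumes subspace: "cfun.subspace W"
    and closed: "\<And>p v. p permutes {1..k} \<Longrightarrow> v \<in> W \<Longrightarrow> act p v \<in> W"
    and act_add: "\<And>p v w. p permutes {1..k} \<Longrightarrow> v \<in> W \<Longrightarrow> w \<in> W \<Longrightarrow> act p (v + w) = act p v + act p w"
    and act_scale: "\<And>p c v. p permutes {1..k} \<Longrightarrow> v \<in> W \<Longrightarrow> act p (cscale c v) = cscale c (act p v)"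
    and act_id: "\<And>v. v \<in> W \<Longrightarrow> act id v = v"
    and act_comp: "\<And>p q v. p permutes {1..k} \<Longrightarrow> q permutes {1..k} \<Longrightarrow> v \<in> W \<Longrightarrow>
      act (p \<circ> q) v = act p (act q v)"

definition irreducible_sym_module ::
  "nat \<Rightarrow> ('b \<Rightarrow> complex) set \<Rightarrow> ((nat \<Rightarrow> nat) \<Rightarrow> ('b \<Rightarrow> complex) \<Rightarrow> 'b \<Rightarrow> complex) \<Rightarrow> bool" where
  "irreducible_sym_module k W act \<longleftrightarrow>
     sym_module k W act \<and> W \<noteq> {0} \<and>
     (\<forall>U. U \<subseteq> W \<and> sym_module k U act \<longrightarrow> U = {0} \<or> U = W)"

definition isomorphic_sym_modules ::
  "nat \<Rightarrow> ('a \<Rightarrow> complex) set \<Rightarrow> ((nat \<Rightarrow> nat) \<Rightarrow> ('a \<Rightarrow> complex) \<Rightarrow> 'a \<Rightarrow> complex)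
       \<Rightarrow> ('b \<Rightarrow> complex) set \<Rightarrow> ((nat \<Rightarrow> nat) \<Rightarrow> ('b \<Rightarrow> complex) \<Rightarrow> 'b \<Rightarrow> complex) \<Rightarrow> bool" where
  "isomorphic_sym_modules k W act W' act' \<longleftrightarrow>
     (\<exists>\<phi>. bij_betw \<phi> W W' \<and>
        (\<forall>v\<in>W. \<forall>w\<in>W. \<phi> (v + w) = \<phi> v + \<phi> w) \<and>
        (\<forall>c. \<forall>v\<in>W. \<phi> (cscale c v) = cscale c (\<phi> v)) \<and>
        (\<forall>p. p permutes {1..k} \<longrightarrow> (\<forall>v\<in>W. \<phi> (act p v) = act' p (\<phi> v))))"

type_synonym galg = "(nat \<Rightarrow> nat) \<Rightarrow> complex"

definition group_algebra :: "nat \<Rightarrow> galg set" where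
  "group_algebra n = {a. \<forall>p. a p \<noteq> 0 \<longrightarrow> p permutes {1..n}}"

definition group_elem :: "(nat \<Rightarrow> nat) \<Rightarrow> galg" where
  "group_elem p = (\<lambda>q. if q = p then 1 else 0)"

text \<open>The action of an element \<open>a\<close> of the group algebra obtained by linear extension of an action
  of the group.\<close>

definition alg_act ::
  "((nat \<Rightarrow> nat) \<Rightarrow> ('b \<Rightarrow> complex) \<Rightarrow> 'b \<Rightarrow> complex) \<Rightarrow> galg \<Rightarrow> ('b \<Rightarrow> complex) \<Rightarrow> 'b \<Rightarrow> complex" where
  "alg_act act a v = (\<Sum>p | a p \<noteq> 0. cscale (a p) (act p v))"

text \<open>The coefficient of \<open>q\<close> in \<open>p \<cdot> a\<close> is the coefficient of \<open>p\<^sup>-\<^sup>1 q\<close> in \<open>a\<close>. The product of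
  the group algebra is written \<open>\<star>\<close>; the operation \<open>*\<close> on functions is pointwise.\<close>

definition left_mult :: "(nat \<Rightarrow> nat) \<Rightarrow> galg \<Rightarrow> galg" where
  "left_mult p a = (\<lambda>q. a (inv p \<circ> q))"

definition galg_mult :: "galg \<Rightarrow> galg \<Rightarrow> galg" (infixl "\<star>" 70) where
  "a \<star> b = alg_act left_mult a b"

lemma group_elem_mult:
  assumes "p permutes {1..n}"
  shows "group_elem p \<star> group_elem q = group_elem (p \<circ> q)"
proof -
  have "inv p \<circ> r = q \<longleftrightarrow> r = p \<circ> q" for r
    using permutes_inv_o[OF assms] by (metis comp_assoc comp_id id_comp)
  moreover have "{r. group_elem p r \<noteq> 0} = {p}"
    by (auto simp: group_elem_def)
  ultimately show ?thesis
    by (auto simp: galg_mult_def alg_act_def left_mult_def group_elem_def cscale_def fun_eq_iff)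
qed

definition jucys_murphy :: "nat \<Rightarrow> galg" where
  "jucys_murphy k = (\<Sum>i\<in>{1..<k}. group_elem (transpose i k))"

definition galg_inner :: "nat \<Rightarrow> galg \<Rightarrow> galg \<Rightarrow> complex" where
  "galg_inner n a b = (\<Sum>p | p permutes {1..n}. a p * cnj (b p))"

lemma galg_inner_group_elem:
  assumes "p permutes {1..n}" "q permutes {1..n}"
  shows "galg_inner n (group_elem p) (group_elem q) = (if p = q then 1 else 0)"
proof -
  have "finite {p. p permutes {1..n}}"
    by (simp add: finite_permutations)
  moreover have "galg_inner n (group_elem p) (group_elem q) =
      (\<Sum>r | r permutes {1..n}. if r = p then (if p = q then 1 else 0) else 0)"
    unfolding galg_inner_def group_elem_def by (intro sum.cong) auto
  ultimately show ?thesis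
    using assms by simp
qed

definition induced :: "nat \<Rightarrow> galg set \<Rightarrow> galg set" where
  "induced k U = cfun.span {a \<star> u | a u. a \<in> group_algebra k \<and> u \<in> U}"

text \<open>Boxes are pairs (row, column), counted from 0, and a partition is given by its Young diagram.\<close>

definition young_diagram :: "(nat \<times> nat) set \<Rightarrow> bool" where
  "young_diagram D \<longleftrightarrow> finite D \<and>
     (\<forall>r c r' c'. (r, c) \<in> D \<and> r' \<le> r \<and> c' \<le> c \<longrightarrow> (r', c') \<in> D)"

definition cont :: "nat \<times> nat \<Rightarrow> int" where
  "cont b = int (snd b) - int (fst b)"

text \<open>A tableau is a function giving the entry of each box and \<open>0\<close> outside of its shape.\<close>

type_synonym tableau = "nat \<times> nat \<Rightarrow> nat"

definition shape :: "tableau \<Rightarrow> (nat \<times> nat) set" where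
  "shape T = {b. T b \<noteq> 0}"

definition standard_tableau :: "nat \<Rightarrow> tableau \<Rightarrow> bool" where
  "standard_tableau n T \<longleftrightarrow>
     young_diagram (shape T) \<and> bij_betw T (shape T) {1..n} \<and>
     (\<forall>r c c'. (r, c) \<in> shape T \<and> (r, c') \<in> shape T \<and> c < c' \<longrightarrow> T (r, c) < T (r, c')) \<and>
     (\<forall>r r' c. (r, c) \<in> shape T \<and> (r', c) \<in> shape T \<and> r < r' \<longrightarrow> T (r, c) < T (r', c))"

definition box :: "tableau \<Rightarrow> nat \<Rightarrow> nat \<times> nat" where
  "box T i = inv_into (shape T) T i"

definition subtableau :: "tableau \<Rightarrow> nat \<Rightarrow> tableau" where
  "subtableau T i = (\<lambda>b. if T b \<le> i then T b else 0)"

text \<open>\<open>is_V k D W act\<close>: the \<open>S\<^sub>k\<close>-module \<open>(W, act)\<close> is the module \<open>V\<^sub>\<lambda>\<close> for the partition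
  \<open>\<lambda>\<close> of \<open>k\<close> with diagram \<open>D\<close>; this determines it up to isomorphism.\<close>

definition is_V :: "nat \<Rightarrow> (nat \<times> nat) set \<Rightarrow> ('b \<Rightarrow> complex) set
    \<Rightarrow> ((nat \<Rightarrow> nat) \<Rightarrow> ('b \<Rightarrow> complex) \<Rightarrow> 'b \<Rightarrow> complex) \<Rightarrow> bool" where
  "is_V k D W act \<longleftrightarrow>
     irreducible_sym_module k W act \<and>
     (\<exists>v. let I = {T. standard_tableau k T \<and> shape T = D} in
        inj_on v I \<and> cfun.independent (v ` I) \<and> cfun.span (v ` I) = W \<and>
        (\<forall>T\<in>I. \<forall>i\<in>{1..k}. alg_act act (jucys_murphy i) (v T) = cscale (of_int (cont (box T i))) (v T)))"

text \<open>\<open>is_V_tableau k T M\<close>: the subspace \<open>M\<close> of the group algebra of \<open>S\<^sub>k\<close> is \<open>V\<^sub>T\<close>, for a standard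
  tableau \<open>T\<close> with \<open>k\<close> boxes. As induced modules are multiplicity-free, there is exactly one such
  \<open>M\<close>. The copy \<open>W\<close> of \<open>V\<^sub>\<lambda>\<close> is taken on functions of tableaux, where there is room for a
  basis indexed by standard tableaux.\<close>

inductive is_V_tableau :: "nat \<Rightarrow> tableau \<Rightarrow> galg set \<Rightarrow> bool" where
  one: "standard_tableau 1 T \<Longrightarrow> is_V_tableau 1 T (group_algebra 1)"
| step: "\<lbrakk>2 \<le> k; standard_tableau k T; is_V_tableau (k - 1) (subtableau T (k - 1)) U;
     M \<subseteq> induced k U; irreducible_sym_module k M left_mult;
     is_V k (shape T) (W :: (tableau \<Rightarrow> complex) set) act;
     isomorphic_sym_modules k M left_mult W act\<rbrakk>
   \<Longrightarrow> is_V_tableau k T M"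

definition is_weight_basis :: "nat \<Rightarrow> (tableau \<Rightarrow> tableau \<Rightarrow> galg) \<Rightarrow> bool" where
  "is_weight_basis n v \<longleftrightarrow>
     (\<exists>V. \<forall>T. standard_tableau n T \<longrightarrow>
        is_V_tableau n T (V T) \<and>
        (\<forall>T'. standard_tableau n T' \<and> shape T' = shape T \<longrightarrow>
           v T' T \<in> V T \<and> v T' T \<noteq> 0 \<and>
           (\<forall>i\<in>{1..n}. jucys_murphy i \<star> v T' T = cscale (of_int (cont (box T' i))) (v T' T))))"

end

theory Submission imports Defs begin

text \<open>
  The vectors \<open>v T' T\<close> are simultaneous eigenvectors of two families of operators on the group
  algebra, both self-adjoint for the standard inner product. Left multiplication by the
  Jucys--Murphy element \<open>X\<^sub>i\<close> has eigenvalue \<open>cont (box T' i)\<close>, by definition. The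
  point is that right multiplication by \<open>Z\<^sub>k = X\<^sub>1 + \<dots> + X\<^sub>k\<close> also acts by a scalar, which is
  read off from \<open>T\<close>: the sum of the contents of the boxes of \<open>T\<close> with entries at most \<open>k\<close>.

  Indeed \<open>Z\<^sub>k\<close> is the sum of all transpositions in \<open>S\<^sub>k\<close>, hence central in the group algebra of
  \<open>S\<^sub>k\<close>. On \<open>V\<^sub>\<lambda>\<close>, for \<open>\<lambda>\<close> a partition of \<open>k\<close>, it acts by the sum of the contents of \<open>\<lambda>\<close>, because
  every vector of the weight basis of \<open>V\<^sub>\<lambda>\<close> has that eigenvalue (\<open>is_V_sum_transpositions\<close>). Let \<open>U\<^sub>k\<close>
  be the module of the subtableau \<open>subtableau T k\<close>, a left ideal of the group algebra of \<open>S\<^sub>k\<close>.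
  By centrality, right multiplication by \<open>Z\<^sub>k\<close> acts on \<open>U\<^sub>k\<close> by the same scalar
  (\<open>right_mult_transpositions_eq_left\<close>). Right and left multiplications commute, so it still acts by
  this scalar on the left ideal that \<open>U\<^sub>k\<close> generates in a larger group algebra, and this ideal
  contains the module of \<open>T\<close> (\<open>is_V_tableau_right_eigenvalue\<close>).

  A standard tableau is determined by the contents of the boxes of \<open>1, 2, \<dots>\<close>
  (\<open>standard_tableau_eqI\<close>), hence also by their partial sums. Two different pairs of tableaux
  therefore differ in an eigenvalue of some operator of one of the two families, and eigenvectors of
  a self-adjoint operator for different real eigenvalues are orthogonal.
\<close>

section \<open>Standard tableaux and contents\<close>

lemma box_works:
  assumes "standard_tableau n T" "i \<in> {1..n}"
  shows "box T i \<in> shape T" "T (box T i) = i"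
proof -
  have "i \<in> T ` shape T"
    using assms by (auto simp: standard_tableau_def bij_betw_def)
  then show "box T i \<in> shape T" "T (box T i) = i"
    unfolding box_def by (auto intro: inv_into_into f_inv_into_f)
qed

lemma box_entry:
  assumes "standard_tableau n T" "b \<in> shape T"
  shows "T b \<in> {1..n}" "box T (T b) = b"
  using assms unfolding standard_tableau_def bij_betw_def box_def by auto

lemma sum_cont_box:
  assumes "standard_tableau n T"
  shows "(\<Sum>i\<in>{1..n}. cont (box T i)) = (\<Sum>b\<in>shape T. cont b)"
proof -
  have "bij_betw T (shape T) {1..n}"
    using assms by (simp add: standard_tableau_def)
  from sum.reindex_bij_betw[OF this, of "\<lambda>i. cont (box T i)"] show ?thesis
    using box_entry(2)[OF assms] by simp
qed

lemma cont_box_1: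
  assumes "standard_tableau 1 T"
  shows "cont (box T 1) = 0"
proof -
  obtain r c where rc: "box T 1 = (r, c)" by fastforce
  have mem: "(r, c) \<in> shape T" and "T (r, c) = 1"
    using box_works[OF assms, of 1] rc by auto
  moreover have "(0, 0) \<in> shape T"
    using assms mem by (auto simp: standard_tableau_def young_diagram_def)
  moreover from this have "T (0, 0) = 1"
    using box_entry(1)[OF assms] by simp
  ultimately have "(r, c) = (0, 0)"
    using assms by (metis box_entry(2))
  with rc show ?thesis by (simp add: cont_def)
qed

text \<open>The corner \<open>(r, c')\<close> of the rectangle spanned by the two boxes lies in the diagram, and its entry
  is between theirs.\<close>

lemma entry_less_diagonal:
  assumes "standard_tableau n T" "(r', c') \<in> shape T" "r < r'" "c < c'"
  shows "(r, c) \<in> shape T" "T (r, c) < T (r', c')"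
proof -
  have yd: "young_diagram (shape T)"
    using assms by (simp add: standard_tableau_def)
  show mem: "(r, c) \<in> shape T"
    using yd assms unfolding young_diagram_def by (meson less_imp_le)
  have mem': "(r, c') \<in> shape T"
    using yd assms unfolding young_diagram_def by (meson less_imp_le order_refl)
  have "T (r, c) < T (r, c')"
    using assms mem mem' by (auto simp: standard_tableau_def)
  also have "\<dots> < T (r', c')"
    using assms mem' by (auto simp: standard_tableau_def)
  finally show "T (r, c) < T (r', c')" .
qed

text \<open>If the boxes of \<open>i\<close> in \<open>T\<close> and \<open>S\<close> lie on one diagonal but differ, one of them is strictly
  above and to the left of the other. It then carries an entry \<open>j < i\<close> in the other tableau, and
  \<open>j\<close> sits in the same box in both.\<close>

lemma box_not_above_diagonal:
  assumes T: "standard_tableau n T" and S: "standard_tableau n S" and i: "i \<in> {1..n}"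
    and less: "\<And>j. j \<in> {1..n} \<Longrightarrow> j < i \<Longrightarrow> box T j = box S j"
    and cont: "cont (box T i) = cont (box S i)"
  shows "\<not> fst (box T i) < fst (box S i)"
proof
  assume lt: "fst (box T i) < fst (box S i)"
  obtain r c r' c' where rc: "box T i = (r, c)" "box S i = (r', c')" by fastforce
  have "r < r'" "c < c'"
    using lt cont rc by (auto simp: cont_def)
  moreover have "(r', c') \<in> shape S" "S (r', c') = i"
    using box_works[OF S i] rc by auto
  ultimately have mem: "(r, c) \<in> shape S" and lt: "S (r, c) < i"
    using entry_less_diagonal[OF S] by metis+
  have j: "S (r, c) \<in> {1..n}" and box_j: "box S (S (r, c)) = (r, c)"
    using box_entry[OF S mem] by auto
  then have "box T (S (r, c)) = box T i"
    using less[OF j lt] rc by simp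
  then show False
    using box_works(2)[OF T j] box_works(2)[OF T i] lt by simp
qed

lemma standard_tableau_eqI:
  assumes T: "standard_tableau n T" and S: "standard_tableau n S"
    and cont: "\<And>i. i \<in> {1..n} \<Longrightarrow> cont (box T i) = cont (box S i)"
  shows "T = S"
proof -
  have box: "box T i = box S i" if "i \<in> {1..n}" for i
    using that
  proof (induction i rule: less_induct)
    case (less i)
    have "fst (box T i) = fst (box S i)"
      using box_not_above_diagonal[OF T S less.prems] box_not_above_diagonal[OF S T less.prems]
        less.IH cont[OF less.prems] by (metis linorder_neqE_nat)
    then show ?case
      using cont[OF less.prems] by (simp add: cont_def prod_eq_iff)
  qed
  have "T b = S b" if "b \<in> shape T" for b
    using box_entry[OF T that] box box_works(2)[OF S] by metis
  moreover have "T b = S b" if "b \<in> shape S" for b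
    using box_entry[OF S that] box box_works(2)[OF T] by metis
  ultimately show ?thesis
    unfolding fun_eq_iff shape_def by (metis (mono_tags, lifting) mem_Collect_eq)
qed

lemma standard_tableau_eqI_partial_sums:
  assumes T: "standard_tableau n T" and S: "standard_tableau n S"
    and sums: "\<And>k. k \<in> {1..n} \<Longrightarrow>
      (\<Sum>i\<in>{1..k}. cont (box T i)) = (\<Sum>i\<in>{1..k}. cont (box S i))"
  shows "T = S"
proof (rule standard_tableau_eqI[OF T S])
  fix i assume i: "i \<in> {1..n}"
  then obtain m where m: "i = Suc m"
    by (cases i) auto
  have "(\<Sum>i\<in>{1..m}. cont (box T i)) = (\<Sum>i\<in>{1..m}. cont (box S i))"
    using sums[of m] i m by (cases "m = 0") auto
  with sums[OF i] m show "cont (box T i) = cont (box S i)"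
    by simp
qed

lemma box_subtableau:
  assumes T: "standard_tableau n T" and i: "i \<in> {1..m}" and m: "m \<le> n"
    and T': "standard_tableau m (subtableau T m)"
  shows "box (subtableau T m) i = box T i"
proof -
  let ?b = "box (subtableau T m) i"
  have "subtableau T m ?b = i"
    using box_works(2)[OF T' i] .
  then have "T ?b = i"
    using i by (auto simp: subtableau_def split: if_splits)
  moreover from this have "?b \<in> shape T"
    using i by (simp add: shape_def)
  ultimately show ?thesis
    using box_entry(2)[OF T] by metis
qed

section \<open>Sums of transpositions\<close>

definition transpositions :: "nat \<Rightarrow> (nat \<Rightarrow> nat) set" where
  "transpositions k = {t. \<exists>i j. 1 \<le> j \<and> j < i \<and> i \<le> k \<and> t = transpose j i}"

lemma transpose_inject:
  assumes "transpose j i = transpose j' i'" "j < i" "j' < (i' :: nat)"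
  shows "j = j' \<and> i = i'"
proof -
  have moved: "{x. transpose a b x \<noteq> x} = {a, b}" if "a < b" for a b :: nat
    using that by (auto simp: transpose_def split: if_splits)
  have "{j, i} = {j', i'}"
    using moved[OF assms(2)] moved[OF assms(3)] assms(1) by simp
  then show ?thesis
    using assms(2,3) by (auto simp: doubleton_eq_iff)
qed

lemma sum_transpositions:
  "(\<Sum>i\<in>{1..k}. \<Sum>j\<in>{1..<i}. f (transpose j i)) = (\<Sum>t\<in>transpositions k. f t)"
proof -
  let ?A = "Sigma {1..k} (\<lambda>i. {1..<i})"
  have "bij_betw (\<lambda>(i, j). transpose j i) ?A (transpositions k)"
    unfolding bij_betw_def
  proof
    show "inj_on (\<lambda>(i, j). transpose j i) ?A"
      by (auto simp: inj_on_def dest: transpose_inject)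
    show "(\<lambda>(i, j). transpose j i) ` ?A = transpositions k"
      by (force simp: transpositions_def image_iff)
  qed
  from sum.reindex_bij_betw[OF this, of f] show ?thesis
    by (simp add: sum.Sigma case_prod_unfold)
qed

lemma transpositions_permutes:
  assumes "t \<in> transpositions k"
  shows "t permutes {1..k}"
  using assms by (auto simp: transpositions_def intro!: permutes_swap_id)

lemma transpositions_mono: "k \<le> n \<Longrightarrow> transpositions k \<subseteq> transpositions n"
  by (force simp: transpositions_def)

lemma transpositions_involution: "t \<in> transpositions k \<Longrightarrow> t \<circ> t = id"
  by (auto simp: transpositions_def)

lemma transpositions_inv: "t \<in> transpositions k \<Longrightarrow> inv t = t"
  by (auto simp: transpositions_def)

lemma conjugate_transposition:
  assumes q: "q permutes {1..k}" and t: "t \<in> transpositions k"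
  shows "q \<circ> t \<circ> inv q \<in> transpositions k"
proof -
  obtain i j where ij: "1 \<le> j" "j < i" "i \<le> k" "t = transpose j i"
    using t by (auto simp: transpositions_def)
  have eq: "q \<circ> t \<circ> inv q = transpose (q j) (q i)"
  proof
    fix x
    have "q (inv q x) = x"
      using q by (simp add: permutes_inverses)
    then show "(q \<circ> t \<circ> inv q) x = transpose (q j) (q i) x"
      using ij(4) permutes_inj[OF q] by (auto simp: transpose_def inj_eq)
  qed
  have "q j \<in> {1..k}" "q i \<in> {1..k}" "q j \<noteq> q i"
    using permutes_in_image[OF q] permutes_inj[OF q] ij by (auto simp: inj_eq)
  then consider "q j < q i" | "q i < q j"
    by linarith
  then show ?thesis
  proof cases
    case 1
    then show ?thesis
      unfolding eq transpositions_def using \<open>q j \<in> _\<close> \<open>q i \<in> _\<close> by auto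
  next
    case 2
    then show ?thesis
      unfolding eq transpositions_def using \<open>q j \<in> _\<close> \<open>q i \<in> _\<close>
      by (auto simp: transpose_commute[of "q j"])
  qed
qed

lemma bij_betw_conjugate_transpositions:
  assumes q: "q permutes {1..k}"
  shows "bij_betw (\<lambda>t. q \<circ> t \<circ> inv q) (transpositions k) (transpositions k)"
proof (rule bij_betw_byWitness[where f' = "\<lambda>t. inv q \<circ> t \<circ> q"])
  have inv: "inv q \<circ> q = id" "q \<circ> inv q = id"
    using permutes_inv_o[OF q] by auto
  have "inv q \<circ> (q \<circ> t \<circ> inv q) \<circ> q = (inv q \<circ> q) \<circ> t \<circ> (inv q \<circ> q)" for t
    by (simp only: o_assoc)
  then show "\<forall>t\<in>transpositions k. inv q \<circ> (q \<circ> t \<circ> inv q) \<circ> q = t"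
    by (simp add: inv)
  have "q \<circ> (inv q \<circ> t \<circ> q) \<circ> inv q = (q \<circ> inv q) \<circ> t \<circ> (q \<circ> inv q)" for t
    by (simp only: o_assoc)
  then show "\<forall>t\<in>transpositions k. q \<circ> (inv q \<circ> t \<circ> q) \<circ> inv q = t"
    by (simp add: inv)
  show "(\<lambda>t. q \<circ> t \<circ> inv q) ` transpositions k \<subseteq> transpositions k"
    using conjugate_transposition[OF q] by auto
  have "inv (inv q) = q"
    using q by (simp add: permutes_inv_inv)
  then show "(\<lambda>t. inv q \<circ> t \<circ> q) ` transpositions k \<subseteq> transpositions k"
    using conjugate_transposition[OF permutes_inv[OF q]] by auto
qed

text \<open>This is right multiplication by \<open>X\<^sub>1 + \<dots> + X\<^sub>k\<close>: a transposition is its own inverse.\<close>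

lemma sum_fun_apply: "(\<Sum>t\<in>A. f t) x = (\<Sum>t\<in>A. f t x)"
  by (induction A rule: infinite_finite_induct) auto

definition right_mult_transpositions :: "nat \<Rightarrow> galg \<Rightarrow> galg" where
  "right_mult_transpositions k a = (\<lambda>q. \<Sum>t\<in>transpositions k. a (q \<circ> t))"

text \<open>Centrality of the sum of all transpositions: \<open>q \<circ> t = (q \<circ> t \<circ> inv q) \<circ> q\<close>, and conjugation by
  \<open>q\<close> permutes the transpositions.\<close>

lemma right_mult_transpositions_eq_left:
  assumes a: "a \<in> group_algebra k"
  shows "right_mult_transpositions k a = (\<Sum>t\<in>transpositions k. left_mult t a)"
proof
  fix q
  have left: "(\<Sum>t\<in>transpositions k. left_mult t a) q = (\<Sum>t\<in>transpositions k. a (t \<circ> q))"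
    by (simp add: sum_fun_apply left_mult_def transpositions_inv)
  show "right_mult_transpositions k a q = (\<Sum>t\<in>transpositions k. left_mult t a) q"
  proof (cases "q permutes {1..k}")
    case True
    have "(q \<circ> t \<circ> inv q) \<circ> q = q \<circ> t" for t
      using permutes_inv_o[OF True] by (simp add: comp_assoc)
    then show ?thesis
      using sum.reindex_bij_betw[OF bij_betw_conjugate_transpositions[OF True], of "\<lambda>t. a (t \<circ> q)"]
      unfolding left by (simp add: right_mult_transpositions_def)
  next
    case False
    \<comment> \<open>Then neither \<open>q \<circ> t\<close> nor \<open>t \<circ> q\<close> is in the support of \<open>a\<close>.\<close>
    have "\<not> (q \<circ> t) permutes {1..k}" "\<not> (t \<circ> q) permutes {1..k}" if "t \<in> transpositions k" for t
    proof -
      have inv: "(q \<circ> t) \<circ> t = q" "t \<circ> (t \<circ> q) = q"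
        using transpositions_involution[OF that] by (metis comp_assoc comp_id id_comp)+
      show "\<not> (q \<circ> t) permutes {1..k}" "\<not> (t \<circ> q) permutes {1..k}"
        using False inv permutes_compose transpositions_permutes[OF that] by metis+
    qed
    then have "a (q \<circ> t) = 0" "a (t \<circ> q) = 0" if "t \<in> transpositions k" for t
      using a that by (auto simp: group_algebra_def)
    then show ?thesis
      unfolding left by (simp add: right_mult_transpositions_def)
  qed
qed

lemma alg_act_jucys_murphy:
  "alg_act act (jucys_murphy i) v = (\<Sum>j\<in>{1..<i}. act (transpose j i) v)"
proof -
  let ?A = "(\<lambda>j. transpose j i) ` {1..<i}"
  have inj: "inj_on (\<lambda>j. transpose j i) {1..<i}"
    by (auto simp: inj_on_def dest: transpose_inject)
  have "jucys_murphy i q = (\<Sum>p\<in>?A. if q = p then 1 else 0)" for q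
    by (simp only: jucys_murphy_def sum_fun_apply group_elem_def sum.reindex[OF inj] comp_def)
  then have jm: "jucys_murphy i q = (if q \<in> ?A then 1 else 0)" for q
    by simp
  then have "{q. jucys_murphy i q \<noteq> 0} = ?A"
    by auto
  then have "alg_act act (jucys_murphy i) v = (\<Sum>q\<in>?A. act q v)"
    unfolding alg_act_def using jm by (intro sum.cong) (auto simp: cscale_def)
  then show ?thesis
    by (simp only: sum.reindex[OF inj] comp_def)
qed

section \<open>Self-adjoint operators and orthogonality\<close>

lemma galg_inner_sum_left: "galg_inner n (\<Sum>t\<in>A. f t) b = (\<Sum>t\<in>A. galg_inner n (f t) b)"
  unfolding galg_inner_def
  by (subst sum.swap) (simp add: sum_fun_apply sum_distrib_right)

lemma galg_inner_sum_right: "galg_inner n a (\<Sum>t\<in>A. f t) = (\<Sum>t\<in>A. galg_inner n a (f t))"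
  unfolding galg_inner_def
  by (subst sum.swap) (simp add: sum_fun_apply sum_distrib_left)

lemma orthogonal_if_eigenvalues_neq:
  assumes "galg_inner n (F a) b = galg_inner n a (F b)"
    and "F a = cscale (of_int x) a" "F b = cscale (of_int y) b" "x \<noteq> y"
  shows "galg_inner n a b = 0"
proof -
  have "of_int x * galg_inner n a b = of_int y * galg_inner n a b"
    using assms(1) unfolding assms(2,3)
    by (simp add: galg_inner_def cscale_def sum_distrib_left mult_ac)
  then show ?thesis
    using assms(4) by simp
qed

lemma galg_inner_transposition:
  assumes t: "t \<in> transpositions n"
  shows "galg_inner n (\<lambda>q. a (q \<circ> t)) b = galg_inner n a (\<lambda>q. b (q \<circ> t))" (is ?right)
    and "galg_inner n (left_mult t a) b = galg_inner n a (left_mult t b)" (is ?left)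
proof -
  have perm: "t permutes {1..n}" and inv: "t \<circ> t = id"
    using t by (auto dest: transpositions_permutes transpositions_involution)
  have cancel: "(q \<circ> t) \<circ> t = q" "t \<circ> (t \<circ> q) = q" for q
    using inv by (metis comp_assoc comp_id id_comp)+
  show ?right
    unfolding galg_inner_def
    by (rule sum.reindex_bij_witness[where i = "\<lambda>q. q \<circ> t" and j = "\<lambda>q. q \<circ> t"])
      (auto simp: cancel intro: permutes_compose perm[simplified])
  show ?left
    unfolding galg_inner_def left_mult_def transpositions_inv[OF t]
    by (rule sum.reindex_bij_witness[where i = "\<lambda>q. t \<circ> q" and j = "\<lambda>q. t \<circ> q"])
      (auto simp: cancel intro: permutes_compose perm[simplified])
qed

lemma jucys_murphy_self_adjoint:
  assumes "i \<le> n"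
  shows "galg_inner n (jucys_murphy i \<star> a) b = galg_inner n a (jucys_murphy i \<star> b)"
proof -
  have "transpose j i \<in> transpositions n" if "j \<in> {1..<i}" for j
    using that assms by (auto simp: transpositions_def)
  then show ?thesis
    by (simp add: galg_mult_def alg_act_jucys_murphy galg_inner_sum_left galg_inner_sum_right
        galg_inner_transposition(2))
qed

lemma right_mult_transpositions_self_adjoint:
  assumes "k \<le> n"
  shows "galg_inner n (right_mult_transpositions k a) b =
    galg_inner n a (right_mult_transpositions k b)"
proof -
  have "right_mult_transpositions k a = (\<Sum>t\<in>transpositions k. (\<lambda>q. a (q \<circ> t)))" for a
    by (simp add: right_mult_transpositions_def fun_eq_iff sum_fun_apply)
  moreover have "galg_inner n (\<lambda>q. a (q \<circ> t)) b = galg_inner n a (\<lambda>q. b (q \<circ> t))"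
    if "t \<in> transpositions k" for t
    using that transpositions_mono[OF assms] by (intro galg_inner_transposition(1)) auto
  ultimately show ?thesis
    by (simp add: galg_inner_sum_left galg_inner_sum_right)
qed

section \<open>The sum of all transpositions on irreducible modules\<close>

lemma sym_module_sum_closed:
  assumes "sym_module k W act" "v \<in> W" "\<And>t. t \<in> A \<Longrightarrow> t permutes {1..k}"
  shows "(\<Sum>t\<in>A. act t v) \<in> W"
  using assms by (intro cfun.subspace_sum) (auto simp: sym_module_def)

lemma cscale_sum_right: "cscale c (\<Sum>t\<in>A. f t) = (\<Sum>t\<in>A. cscale c (f t))"
  by (simp add: cscale_def fun_eq_iff sum_fun_apply sum_distrib_left)

text \<open>The eigenvalue of \<open>X\<^sub>1 + \<dots> + X\<^sub>k\<close> at \<open>v\<^sub>T\<close> is the sum of the contents of all boxes of \<open>T\<close>, which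
  depends on the shape only.\<close>

lemma is_V_sum_transpositions:
  assumes V: "is_V k D W act" and w: "w \<in> W"
  shows "(\<Sum>t\<in>transpositions k. act t w) = cscale (of_int (\<Sum>b\<in>D. cont b)) w"
proof -
  define I where "I = {T. standard_tableau k T \<and> shape T = D}"
  define c where "c = (of_int (\<Sum>b\<in>D. cont b) :: complex)"
  obtain v where span: "cfun.span (v ` I) = W"
    and jm: "\<And>T i. T \<in> I \<Longrightarrow> i \<in> {1..k} \<Longrightarrow>
      alg_act act (jucys_murphy i) (v T) = cscale (of_int (cont (box T i))) (v T)"
    using V unfolding is_V_def Let_def I_def by blast
  have mod: "sym_module k W act"
    using V by (simp add: is_V_def irreducible_sym_module_def)
  let ?E = "{w \<in> W. (\<Sum>t\<in>transpositions k. act t w) = cscale c w}"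
  have base: "v T \<in> ?E" if T: "T \<in> I" for T
  proof -
    have "(\<Sum>t\<in>transpositions k. act t (v T)) = (\<Sum>i\<in>{1..k}. alg_act act (jucys_murphy i) (v T))"
      by (simp add: alg_act_jucys_murphy sum_transpositions[symmetric])
    also have "\<dots> = (\<Sum>i\<in>{1..k}. cscale (of_int (cont (box T i))) (v T))"
      using jm[OF T] by simp
    also have "\<dots> = cscale (of_int (\<Sum>i\<in>{1..k}. cont (box T i))) (v T)"
      by (simp add: cscale_def fun_eq_iff sum_fun_apply sum_distrib_right)
    also have "\<dots> = cscale c (v T)"
      using T sum_cont_box[of k T] by (simp add: I_def c_def)
    finally have "(\<Sum>t\<in>transpositions k. act t (v T)) = cscale c (v T)" .
    moreover have "v T \<in> W"
      using T cfun.span_base[of "v T" "v ` I"] span by blast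
    ultimately show ?thesis
      by blast
  qed
  have perm: "t permutes {1..k}" if "t \<in> transpositions k" for t
    using that by (rule transpositions_permutes)
  have "cfun.subspace ?E"
    unfolding cfun.subspace_def
  proof (intro conjI ballI allI)
    have sub: "cfun.subspace W"
      using mod by (simp add: sym_module_def)
    have zero: "0 \<in> W"
      using sub by (rule cfun.subspace_0)
    have "act t 0 = 0" if "t \<in> transpositions k" for t
      using sym_module.act_scale[OF mod perm[OF that] zero, of 0]
      by simp
    then have "(\<Sum>t\<in>transpositions k. act t 0) = 0"
      by (intro sum.neutral) auto
    then show "0 \<in> ?E"
      using zero by (simp only: mem_Collect_eq cfun.scale_zero_right simp_thms)
    fix x assume x: "x \<in> ?E"
    have "(\<Sum>t\<in>transpositions k. act t (x + y)) = cscale c (x + y)" if y: "y \<in> ?E" for y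
    proof -
      have "(\<Sum>t\<in>transpositions k. act t (x + y)) = (\<Sum>t\<in>transpositions k. act t x + act t y)"
        using x y sym_module.act_add[OF mod perm] by (intro sum.cong) auto
      then show ?thesis
        using x y by (simp add: sum.distrib cfun.scale_right_distrib)
    qed
    then show "x + y \<in> ?E" if "y \<in> ?E" for y
      using x that cfun.subspace_add[OF sub] by simp
    have "(\<Sum>t\<in>transpositions k. act t (cscale d x)) = cscale c (cscale d x)" for d
    proof -
      have "(\<Sum>t\<in>transpositions k. act t (cscale d x)) = (\<Sum>t\<in>transpositions k. cscale d (act t x))"
        using x sym_module.act_scale[OF mod perm] by (intro sum.cong) auto
      also have "\<dots> = cscale d (cscale c x)"
        using x by (simp flip: cscale_sum_right)
      finally show ?thesis
        by (simp add: mult.commute)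
    qed
    then show "cscale d x \<in> ?E" for d
      using x cfun.subspace_scale[OF sub] by simp
  qed
  then have "cfun.span (v ` I) \<subseteq> ?E"
    using base by (intro cfun.span_minimal) auto
  then show ?thesis
    using span w by (auto simp: c_def)
qed

lemma isomorphic_sum_transpositions:
  assumes mod: "sym_module k M act" and iso: "isomorphic_sym_modules k M act W act'"
    and scalar: "\<And>w. w \<in> W \<Longrightarrow> (\<Sum>t\<in>transpositions k. act' t w) = cscale c w"
    and m: "m \<in> M"
  shows "(\<Sum>t\<in>transpositions k. act t m) = cscale c m"
proof -
  obtain \<phi> where bij: "bij_betw \<phi> M W"
    and add: "\<And>v w. v \<in> M \<Longrightarrow> w \<in> M \<Longrightarrow> \<phi> (v + w) = \<phi> v + \<phi> w"
    and scale: "\<And>c v. v \<in> M \<Longrightarrow> \<phi> (cscale c v) = cscale c (\<phi> v)"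
    and equiv: "\<And>p v. p permutes {1..k} \<Longrightarrow> v \<in> M \<Longrightarrow> \<phi> (act p v) = act' p (\<phi> v)"
    using iso unfolding isomorphic_sym_modules_def by blast
  have sub: "cfun.subspace M"
    using mod by (simp add: sym_module_def)
  have "\<phi> 0 = 0"
    using scale[OF cfun.subspace_0[OF sub], of 0] by simp
  have sum: "\<phi> (\<Sum>t\<in>A. act t m) = (\<Sum>t\<in>A. act' t (\<phi> m))" if "A \<subseteq> {p. p permutes {1..k}}" for A
  proof -
    have "finite A"
      using that by (rule finite_subset) (simp add: finite_permutations)
    then show ?thesis
      using that
    proof (induction A rule: finite_induct)
      case empty
      then show ?case using \<open>\<phi> 0 = 0\<close> by (metis sum.empty)
    next
      case (insert t A)
      have A: "(\<Sum>t\<in>A. act t m) \<in> M"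
        using insert.prems by (intro sym_module_sum_closed[OF mod m]) auto
      have t: "t permutes {1..k}"
        using insert.prems by auto
      have "act t m \<in> M"
        using sym_module.closed[OF mod t m] .
      then have "\<phi> (act t m + (\<Sum>t\<in>A. act t m)) = act' t (\<phi> m) + \<phi> (\<Sum>t\<in>A. act t m)"
        using add[OF _ A] equiv[OF t m] by simp
      moreover have "\<phi> (\<Sum>t\<in>A. act t m) = (\<Sum>t\<in>A. act' t (\<phi> m))"
        using insert.IH insert.prems by blast
      ultimately show ?case
        by (simp only: sum.insert[OF insert.hyps])
    qed
  qed
  have "\<phi> (\<Sum>t\<in>transpositions k. act t m) = (\<Sum>t\<in>transpositions k. act' t (\<phi> m))"
    using transpositions_permutes by (intro sum) auto
  also have "\<dots> = cscale c (\<phi> m)"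
    using bij m by (intro scalar) (auto dest: bij_betwE)
  also have "\<dots> = \<phi> (cscale c m)"
    using scale m by simp
  finally show ?thesis
    using bij_betw_imp_inj_on[OF bij]
      sym_module_sum_closed[OF mod m transpositions_permutes] cfun.subspace_scale[OF sub m]
    by (auto dest: inj_onD)
qed

section \<open>Eigenvalues of right multiplication\<close>

lemma subspace_group_algebra: "cfun.subspace (group_algebra n)"
  unfolding cfun.subspace_def group_algebra_def
  by (auto simp: cscale_def) (metis add_0)

lemma group_algebra_mono: "k \<le> n \<Longrightarrow> group_algebra k \<subseteq> group_algebra n"
  by (force simp: group_algebra_def intro: permutes_subset)

lemma galg_mult_closed:
  assumes "a \<in> group_algebra n" "b \<in> group_algebra n"
  shows "a \<star> b \<in> group_algebra n"
proof -
  have "left_mult p b \<in> group_algebra n" if "p permutes {1..n}" for p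
    unfolding group_algebra_def
  proof (intro CollectI allI impI)
    fix q assume "left_mult p b q \<noteq> 0"
    then have "(inv p \<circ> q) permutes {1..n}"
      using assms(2) by (simp add: left_mult_def group_algebra_def)
    then have "(p \<circ> (inv p \<circ> q)) permutes {1..n}"
      using that by (rule permutes_compose)
    then show "q permutes {1..n}"
      using permutes_inv_o(1)[OF that] by (simp add: o_assoc)
  qed
  then show ?thesis
    unfolding galg_mult_def alg_act_def using assms(1)
    by (intro cfun.subspace_sum cfun.subspace_scale subspace_group_algebra)
      (auto simp: group_algebra_def)
qed

lemma induced_subset_group_algebra:
  assumes "U \<subseteq> group_algebra n"
  shows "induced n U \<subseteq> group_algebra n"
  unfolding induced_def using assms
  by (intro cfun.span_minimal subspace_group_algebra) (auto intro: galg_mult_closed)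

lemma right_mult_transpositions_galg_mult:
  "right_mult_transpositions k (a \<star> b) = a \<star> right_mult_transpositions k b"
  unfolding right_mult_transpositions_def galg_mult_def alg_act_def left_mult_def cscale_def
  by (subst sum_fun_apply, subst sum.swap)
    (simp add: fun_eq_iff sum_fun_apply sum_distrib_left comp_assoc)

lemma galg_mult_cscale: "a \<star> cscale c b = cscale c (a \<star> b)"
  unfolding galg_mult_def alg_act_def left_mult_def cscale_def
  by (simp add: fun_eq_iff sum_fun_apply sum_distrib_left mult_ac)

lemma subspace_right_eigenspace:
  "cfun.subspace {m. right_mult_transpositions k m = cscale c m}"
  unfolding cfun.subspace_def right_mult_transpositions_def
  by (auto simp: cscale_def fun_eq_iff sum.distrib sum_distrib_left[symmetric] algebra_simps)

lemma right_eigenvalue_induced: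
  assumes "\<And>u. u \<in> U \<Longrightarrow> right_mult_transpositions k u = cscale c u" "m \<in> induced n U"
  shows "right_mult_transpositions k m = cscale c m"
proof -
  have "induced n U \<subseteq> {m. right_mult_transpositions k m = cscale c m}"
    unfolding induced_def using assms(1)
    by (intro cfun.span_minimal subspace_right_eigenspace)
      (auto simp: right_mult_transpositions_galg_mult galg_mult_cscale)
  with assms(2) show ?thesis by auto
qed

text \<open>The induction follows the construction of the module by successive inductions. For \<open>k = n\<close> the
  right eigenvalue comes from the isomorphism type of the module and centrality; for \<open>k < n\<close> it is
  inherited from the module of the smaller tableau.\<close>

lemma is_V_tableau_right_eigenvalue:
  assumes "is_V_tableau n T M"
  shows "standard_tableau n T \<and> M \<subseteq> group_algebra n \<and>
    (\<forall>m\<in>M. \<forall>k\<in>{1..n}.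
      right_mult_transpositions k m = cscale (of_int (\<Sum>i\<in>{1..k}. cont (box T i))) m)"
  using assms
proof (induction rule: is_V_tableau.induct)
  case (one T)
  have "transpositions 1 = {}"
    by (auto simp: transpositions_def)
  then show ?case
    using one cont_box_1[OF one]
    by (auto simp: right_mult_transpositions_def cscale_def)
next
  case (step n T U M W act)
  let ?T' = "subtableau T (n - 1)"
  have T': "standard_tableau (n - 1) ?T'" and U: "U \<subseteq> group_algebra (n - 1)"
    using step.IH by auto
  have "U \<subseteq> group_algebra n"
    using U group_algebra_mono[of "n - 1" n] by auto
  with step.hyps(4) have M: "M \<subseteq> group_algebra n"
    using induced_subset_group_algebra by blast
  have "right_mult_transpositions k m = cscale (of_int (\<Sum>i\<in>{1..k}. cont (box T i))) m"
    if m: "m \<in> M" and k: "k \<in> {1..n}" for m k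
  proof (cases "k = n")
    case True
    have "(\<Sum>t\<in>transpositions n. left_mult t m) = cscale (of_int (\<Sum>b\<in>shape T. cont b)) m"
    proof (rule isomorphic_sum_transpositions
        [where act = left_mult and act' = act and W = W and M = M])
      show "sym_module n M left_mult"
        using step.hyps(5) by (simp add: irreducible_sym_module_def)
      show "isomorphic_sym_modules n M left_mult W act" "m \<in> M"
        by (fact step.hyps(7), fact m)
      show "(\<Sum>t\<in>transpositions n. act t w) = cscale (of_int (\<Sum>b\<in>shape T. cont b)) w"
        if "w \<in> W" for w
        using is_V_sum_transpositions[OF step.hyps(6) that] .
    qed
    moreover have "right_mult_transpositions n m = (\<Sum>t\<in>transpositions n. left_mult t m)"
      using M m by (intro right_mult_transpositions_eq_left) auto
    ultimately show ?thesis
      unfolding True sum_cont_box[OF step.hyps(2)] by (rule trans[rotated])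
  next
    case False
    have "right_mult_transpositions k u = cscale (of_int (\<Sum>i\<in>{1..k}. cont (box T i))) u"
      if "u \<in> U" for u
    proof -
      have sums: "(\<Sum>i\<in>{1..k}. cont (box ?T' i)) = (\<Sum>i\<in>{1..k}. cont (box T i))"
        using k False T' by (intro sum.cong) (auto simp: box_subtableau[OF step.hyps(2)])
      have "k \<in> {1..n - 1}"
        using k False by auto
      then have "right_mult_transpositions k u =
          cscale (of_int (\<Sum>i\<in>{1..k}. cont (box ?T' i))) u"
        by (rule step.IH[THEN conjunct2, THEN conjunct2, THEN bspec, OF that, THEN bspec])
      then show ?thesis
        unfolding sums .
    qed
    then show ?thesis
      by (rule right_eigenvalue_induced) (use step.hyps(4) m in auto)
  qed
  with step.hyps(2) M show ?case
    by blast
qed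

section \<open>Orthogonality of the weight basis\<close>

theorem proposition2p5:
  fixes n :: nat and v :: "tableau \<Rightarrow> tableau \<Rightarrow> galg"
  assumes "n \<ge> 1"
    and "is_weight_basis n v"
    and "standard_tableau n T" "standard_tableau n T'" "shape T' = shape T"
    and "standard_tableau n S" "standard_tableau n S'" "shape S' = shape S"
    and "(T', T) \<noteq> (S', S)"
  shows "galg_inner n (v T' T) (v S' S) = 0"
proof -
  obtain V where
    V: "\<And>T. standard_tableau n T \<Longrightarrow> is_V_tableau n T (V T)" and
    mem: "\<And>T T'. standard_tableau n T \<Longrightarrow> standard_tableau n T' \<Longrightarrow> shape T' = shape T \<Longrightarrow>
      v T' T \<in> V T" and
    left: "\<And>T T' i. standard_tableau n T \<Longrightarrow> standard_tableau n T' \<Longrightarrow> shape T' = shape T \<Longrightarrow>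
      i \<in> {1..n} \<Longrightarrow> jucys_murphy i \<star> v T' T = cscale (of_int (cont (box T' i))) (v T' T)"
    using assms(2) unfolding is_weight_basis_def by metis
  show ?thesis
  proof (cases "T' = S'")
    case False
    then obtain i where i: "i \<in> {1..n}" "cont (box T' i) \<noteq> cont (box S' i)"
      using standard_tableau_eqI assms by metis
    show ?thesis
    proof (rule orthogonal_if_eigenvalues_neq)
      show "galg_inner n (jucys_murphy i \<star> v T' T) (v S' S) =
          galg_inner n (v T' T) (jucys_murphy i \<star> v S' S)"
        using i(1) by (intro jucys_murphy_self_adjoint) simp
    qed (fact left[OF assms(3,4,5) i(1)] left[OF assms(6,7,8) i(1)] i(2))+
  next
    case True
    with assms obtain k where k: "k \<in> {1..n}"
      "(\<Sum>i\<in>{1..k}. cont (box T i)) \<noteq> (\<Sum>i\<in>{1..k}. cont (box S i))"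
      using standard_tableau_eqI_partial_sums by metis
    have right: "right_mult_transpositions k (v T' T) =
        cscale (of_int (\<Sum>i\<in>{1..k}. cont (box T i))) (v T' T)"
      if "standard_tableau n T" "standard_tableau n T'" "shape T' = shape T" for T T'
      using is_V_tableau_right_eigenvalue[OF V[OF that(1)]] mem[OF that] k(1) by blast
    show ?thesis
    proof (rule orthogonal_if_eigenvalues_neq)
      show "galg_inner n (right_mult_transpositions k (v T' T)) (v S' S) =
          galg_inner n (v T' T) (right_mult_transpositions k (v S' S))"
        using k(1) by (intro right_mult_transpositions_self_adjoint) simp
    qed (fact right[OF assms(3,4,5)] right[OF assms(6,7,8)] k(2))+
  qed
qed

end
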